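(* Let $(X,d)$ be a compact metric space, let $f_n:X\to X$ be continuous for every $n\ge0$, let $A=(a_{ij})_{N\times N}$ be a transition matrix, and let $\{V_{i,n}\}_{n=0}^\infty$, $1\le i\le N$, be sequences of nonempty closed subsets of $X$ with $V_{i,n}\cap V_{j,n}=\emptyset$ for all $1\le i\ne j\le N$ and $n\ge0$. Assume that the system $x_{n+1}=f_n(x_n)$ is weakly $A$-coupled-expanding in $\{V_{i,n}\}_{n=0}^\infty$, $1\le i\le N$. Then for every $n\ge0$ there exists a nonempty compact subset $\mathcal C_n\subset\bigcup_{i=1}^N\langle V_{i,n}\rangle$ of $\mathcal K(X)$ with $\bar f_n(\mathcal C_n)=\mathcal C_{n+1}$ such that the invariant subsystem of the induced set-valued system $A_{n+1}=\bar f_n(A_n)$ on $\{\mathcal C_n\}_{n=0}^\infty$ is topologically semiconjugate to $(\Sigma_N^+(A),\sigma_A)$.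
   Context: $\mathcal K(X)$ is the set of all nonempty compact subsets of $X$ with the Hausdorff metric $\mathcal H_d(B,C):=\max\{\sup_{b\in B}d(b,C),\sup_{c\in C}d(c,B)\}$. For nonempty $K\subset X$, $\langle K\rangle:=\{B\in\mathcal K(X):B\subset K\}$; $\bar f_n:\mathcal K(X)\to\mathcal K(X)$ is $\bar f_n(B):=f_n(B)$. In $\bar f_n(\mathcal C_n)$ the map $\bar f_n$ is applied elementwise: $\bar f_n(\mathcal C_n)=\{\bar f_n(B):B\in\mathcal C_n\}$. A transition matrix is a matrix $A=(a_{ij})_{N\times N}$, $N\ge2$, with $a_{ij}\in\{0,1\}$, $\sum_{j=1}^N a_{ij}\ge1$ for all $i$ and $\sum_{i=1}^N a_{ij}\ge1$ for all $j$. The system $x_{n+1}=f_n(x_n)$ is weakly $A$-coupled-expanding in $\{V_{i,n}\}_{n=0}^\infty$, $1\le i\le N$, if $V_{i,n}\cap V_{j,n}=\partial V_{i,n}\cap\partial V_{j,n}$ for all $1\le i\ne j\le N$, $n\ge0$, and $f_n(V_{i,n})\supset\bigcup_{j:\,a_{ij}=1}V_{j,n+1}$ for all $1\le i\le N$, $n\ge0$. $\Sigma_N^+(A):=\{s=(s_0,s_1,\dots):1\le s_j\le N,\ a_{s_js_{j+1}}=1,\ j\ge0\}$, with metric $\hat\rho(\alpha,\beta):=\sum_{i=0}^\infty \hat d(a_i,b_i)/2^i$ for $\alpha=(a_0,a_1,\dots)$, $\beta=(b_0,b_1,\dots)$, where $\hat d(a,b)=0$ if $a=b$ and $1$ otherwise.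 $\sigma_A:\Sigma_N^+(A)\to\Sigma_N^+(A)$, $\sigma_A((s_0,s_1,s_2,\dots)):=(s_1,s_2,\dots)$. For subsets $\mathcal C_n\subset\mathcal K(X)$ with $\bar f_n(\mathcal C_n)\subset\mathcal C_{n+1}$ for all $n\ge0$, the set-valued system restricted to $\{\mathcal C_n\}$ is called its invariant subsystem on $\{\mathcal C_n\}_{n=0}^\infty$. It is topologically semiconjugate to $(\Sigma_N^+(A),\sigma_A)$ if for every $n\ge0$ there is a continuous surjective map $h_n:\mathcal C_n\to\Sigma_N^+(A)$ with $h_{n+1}\circ\bar f_n=\sigma_A\circ h_n$ on $\mathcal C_n$. *)

theory Defs
  imports "HOL-Analysis.Analysis"
begin

section \<open>The hyperspace of nonempty compact subsets\<close>

definition hyperspace :: "'a::metric_space set set" where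
  "hyperspace = {B. B \<noteq> {} \<and> compact B}"

text \<open>For a nonempty set \<open>C\<close>, \<^term>\<open>infdist b C\<close> is the distance \<open>d(b, C)\<close>. The value \<open>0\<close>
  outside \<^const>\<open>hyperspace\<close> is a dummy: the locale \<^locale>\<open>Metric_space\<close> requires
  nonnegativity also off the carrier.\<close>

definition hausdorff_dist :: "'a::metric_space set \<Rightarrow> 'a set \<Rightarrow> real" where
  "hausdorff_dist B C =
    (if B \<in> hyperspace \<and> C \<in> hyperspace
     then max (SUP b\<in>B. infdist b C) (SUP c\<in>C. infdist c B) else 0)"

lemma bdd_above_infdist:
  assumes "compact B" shows "bdd_above ((\<lambda>b. infdist b C) ` B)"
  using assms
  by (intro bounded_imp_bdd_above compact_imp_bounded compact_continuous_image continuous_intros)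

lemma hausdorff_dist_commute: "hausdorff_dist B C = hausdorff_dist C B"
  by (simp add: hausdorff_dist_def max.commute)

lemma infdist_le_hausdorff_dist:
  assumes "B \<in> hyperspace" "C \<in> hyperspace" "b \<in> B"
  shows "infdist b C \<le> hausdorff_dist B C"
  using cSUP_upper[OF assms(3) bdd_above_infdist[of B C]] assms
  unfolding hausdorff_dist_def by (auto simp: hyperspace_def)

lemma hausdorff_dist_leI:
  assumes "B \<in> hyperspace" "C \<in> hyperspace"
    and "\<And>b. b \<in> B \<Longrightarrow> infdist b C \<le> r" "\<And>c. c \<in> C \<Longrightarrow> infdist c B \<le> r"
  shows "hausdorff_dist B C \<le> r"
proof -
  have "B \<noteq> {}" "C \<noteq> {}" using assms(1,2) by (auto simp: hyperspace_def)
  then show ?thesis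
    unfolding hausdorff_dist_def using assms by (auto intro!: cSUP_least)
qed

lemma infdist_hausdorff_triangle:
  assumes B: "B \<in> hyperspace" and C: "C \<in> hyperspace" and D: "D \<in> hyperspace" and b: "b \<in> B"
  shows "infdist b D \<le> hausdorff_dist B C + hausdorff_dist C D"
proof -
  have C': "compact C" "C \<noteq> {}" using C by (auto simp: hyperspace_def)
  have "continuous_on C (dist b)" by (intro continuous_intros)
  then obtain c where c: "c \<in> C" "\<And>c'. c' \<in> C \<Longrightarrow> dist b c \<le> dist b c'"
    using continuous_attains_inf[OF C', of "dist b"] by blast
  have "dist b c \<le> infdist b C"
    using c(2) C'(2) unfolding infdist_def by (auto intro: cINF_greatest)
  have "infdist b D \<le> infdist c D + dist b c" by (rule infdist_triangle)
  then show ?thesis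
    using infdist_le_hausdorff_dist[OF B C b] infdist_le_hausdorff_dist[OF C D c(1)] \<open>dist b c \<le> infdist b C\<close>
    by linarith
qed

lemma hausdorff_dist_nonneg: "0 \<le> hausdorff_dist B C"
proof (cases "B \<in> hyperspace \<and> C \<in> hyperspace")
  case True
  then obtain b where "b \<in> B" by (auto simp: hyperspace_def)
  then show ?thesis
    using True infdist_le_hausdorff_dist infdist_nonneg order_trans by blast
qed (auto simp: hausdorff_dist_def)

lemma hausdorff_dist_zero_subset:
  assumes "B \<in> hyperspace" "C \<in> hyperspace" "hausdorff_dist B C = 0"
  shows "B \<subseteq> C"
proof
  fix b assume "b \<in> B"
  then have "infdist b C = 0"
    using infdist_le_hausdorff_dist[OF assms(1,2)] infdist_nonneg[of b C] assms(3) by fastforce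
  then show "b \<in> C"
    using assms(2) by (auto simp: hyperspace_def in_closed_iff_infdist_zero compact_imp_closed)
qed

lemma Metric_space_hyperspace: "Metric_space hyperspace hausdorff_dist"
proof
  fix B C D :: "'a set"
  show "0 \<le> hausdorff_dist B C" by (rule hausdorff_dist_nonneg)
  show "hausdorff_dist B C = hausdorff_dist C B" by (rule hausdorff_dist_commute)
  assume B: "B \<in> hyperspace" and C: "C \<in> hyperspace"
  show "hausdorff_dist B C = 0 \<longleftrightarrow> B = C"
  proof
    assume "hausdorff_dist B C = 0"
    then show "B = C"
      using hausdorff_dist_zero_subset[OF B C] hausdorff_dist_zero_subset[OF C B]
      by (auto simp: hausdorff_dist_commute)
  next
    assume "B = C"
    then show "hausdorff_dist B C = 0"
      using hausdorff_dist_leI[OF B C, of 0] hausdorff_dist_nonneg[of B C] by auto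
  qed
  assume D: "D \<in> hyperspace"
  show "hausdorff_dist B D \<le> hausdorff_dist B C + hausdorff_dist C D"
  proof (rule hausdorff_dist_leI[OF B D])
    fix d assume "d \<in> D"
    then show "infdist d B \<le> hausdorff_dist B C + hausdorff_dist C D"
      using infdist_hausdorff_triangle[OF D C B] by (simp add: hausdorff_dist_commute add.commute)
  qed (rule infdist_hausdorff_triangle[OF B C D])
qed

definition hyperspace_topology :: "'a::metric_space set topology" where
  "hyperspace_topology = Metric_space.mtopology hyperspace hausdorff_dist"

definition compact_subsets_of :: "'a::metric_space set \<Rightarrow> 'a set set" where
  "compact_subsets_of K = {B \<in> hyperspace. B \<subseteq> K}"

definition induced_map :: "('a \<Rightarrow> 'a) \<Rightarrow> 'a set \<Rightarrow> 'a set" where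
  "induced_map g B = g ` B"


section \<open>Transition matrices and coupled expansion\<close>

text \<open>An \<open>N \<times> N\<close> matrix is a function of two indices, of which only the values at indices in
  \<open>{1..N}\<close> are relevant.\<close>

definition transition_matrix :: "nat \<Rightarrow> (nat \<Rightarrow> nat \<Rightarrow> nat) \<Rightarrow> bool" where
  "transition_matrix N a \<longleftrightarrow>
     N \<ge> 2 \<and>
     (\<forall>i\<in>{1..N}. \<forall>j\<in>{1..N}. a i j \<in> {0, 1}) \<and>
     (\<forall>i\<in>{1..N}. (\<Sum>j=1..N. a i j) \<ge> 1) \<and>
     (\<forall>j\<in>{1..N}. (\<Sum>i=1..N. a i j) \<ge> 1)"

definition weakly_coupled_expanding ::
  "nat \<Rightarrow> (nat \<Rightarrow> nat \<Rightarrow> nat) \<Rightarrow> (nat \<Rightarrow> 'a \<Rightarrow> 'a::metric_space) \<Rightarrow> (nat \<Rightarrow> nat \<Rightarrow> 'a set) \<Rightarrow> bool"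
  where
  "weakly_coupled_expanding N a f V \<longleftrightarrow>
     (\<forall>n. \<forall>i\<in>{1..N}. \<forall>j\<in>{1..N}. i \<noteq> j \<longrightarrow>
        V i n \<inter> V j n = frontier (V i n) \<inter> frontier (V j n)) \<and>
     (\<forall>n. \<forall>i\<in>{1..N}. (\<Union>j\<in>{j\<in>{1..N}. a i j = 1}. V j (Suc n)) \<subseteq> f n ` V i n)"


section \<open>One-sided subshifts of finite type\<close>

definition subshift :: "nat \<Rightarrow> (nat \<Rightarrow> nat \<Rightarrow> nat) \<Rightarrow> (nat \<Rightarrow> nat) set" where
  "subshift N a = {s. \<forall>j. s j \<in> {1..N} \<and> a (s j) (s (Suc j)) = 1}"

definition symbol_dist :: "(nat \<Rightarrow> nat) \<Rightarrow> (nat \<Rightarrow> nat) \<Rightarrow> real" where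
  "symbol_dist s t = (\<Sum>i. (if s i = t i then 0 else 1) / 2 ^ i)"

lemma summable_symbol_dist:
  fixes s t :: "nat \<Rightarrow> nat"
  shows "summable (\<lambda>i. (if s i = t i then 0 else 1) / 2 ^ i :: real)"
proof (rule summable_comparison_test')
  show "summable (\<lambda>i. (1 / 2) ^ i :: real)" by (rule summable_geometric) simp
  show "norm ((if s i = t i then 0 else 1) / 2 ^ i :: real) \<le> (1 / 2) ^ i" if "0 \<le> i" for i
    by (simp add: power_one_over)
qed

lemma Metric_space_subshift: "Metric_space (subshift N a) symbol_dist"
proof
  fix s t u :: "nat \<Rightarrow> nat"
  show "0 \<le> symbol_dist s t"
    unfolding symbol_dist_def by (rule suminf_nonneg[OF summable_symbol_dist]) simp
  show "symbol_dist s t = symbol_dist t s"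
    by (simp add: symbol_dist_def eq_commute)
  show "symbol_dist s t = 0 \<longleftrightarrow> s = t"
    unfolding symbol_dist_def
    by (subst suminf_eq_zero_iff[OF summable_symbol_dist]) (auto split: if_splits)
  show "symbol_dist s u \<le> symbol_dist s t + symbol_dist t u"
    unfolding symbol_dist_def suminf_add[OF summable_symbol_dist summable_symbol_dist]
    by (rule suminf_le[OF _ summable_symbol_dist
          summable_add[OF summable_symbol_dist summable_symbol_dist]])
      (auto simp: field_simps)
qed

definition subshift_topology :: "nat \<Rightarrow> (nat \<Rightarrow> nat \<Rightarrow> nat) \<Rightarrow> (nat \<Rightarrow> nat) topology" where
  "subshift_topology N a = Metric_space.mtopology (subshift N a) symbol_dist"

definition shift_map :: "(nat \<Rightarrow> nat) \<Rightarrow> nat \<Rightarrow> nat" where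
  "shift_map s = (\<lambda>i. s (Suc i))"


section \<open>Invariant subsystems and semiconjugacy\<close>

definition invariant_sequence ::
  "'a topology \<Rightarrow> (nat \<Rightarrow> 'a \<Rightarrow> 'a) \<Rightarrow> (nat \<Rightarrow> 'a set) \<Rightarrow> bool" where
  "invariant_sequence T F C \<longleftrightarrow>
     (\<forall>n. C n \<subseteq> topspace T \<and> F n ` C n \<subseteq> C (Suc n))"

definition subsystem_semiconjugate ::
  "'a topology \<Rightarrow> (nat \<Rightarrow> 'a \<Rightarrow> 'a) \<Rightarrow> (nat \<Rightarrow> 'a set) \<Rightarrow> 'b topology \<Rightarrow> ('b \<Rightarrow> 'b) \<Rightarrow> bool" where
  "subsystem_semiconjugate T F C S g \<longleftrightarrow>
     invariant_sequence T F C \<and>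
     (\<exists>h. \<forall>n. continuous_map (subtopology T (C n)) S (h n) \<and>
              h n ` C n = topspace S \<and>
              (\<forall>x\<in>C n. h (Suc n) (F n x) = g (h n x)))"

end

theory Submission
  imports Defs
begin

text \<open>Singletons suffice: \<open>x \<mapsto> {x}\<close> is an isometric embedding of \<open>X\<close> into the hyperspace, so
  \<open>\<C>\<^sub>n\<close> can be taken to consist of the sets \<open>{x}\<close> with \<open>x\<close> having an admissible itinerary from
  time \<open>n\<close> on, and \<open>h\<^sub>n {x}\<close> is this itinerary. Disjointness makes it unique and locally constant
  in each coordinate; covering and compactness make every itinerary occur.\<close>

section \<open>Singletons in the hyperspace\<close>

lemma singleton_in_hyperspace [simp]: "{x} \<in> hyperspace"
  by (simp add: hyperspace_def)

lemma hausdorff_dist_singletons [simp]: "hausdorff_dist {x} {y} = dist x y"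
  by (simp add: hausdorff_dist_def dist_commute)

lemma topspace_hyperspace_topology [simp]: "topspace hyperspace_topology = hyperspace"
  by (simp add: hyperspace_topology_def Metric_space.topspace_mtopology[OF Metric_space_hyperspace])

text \<open>By the isometry, the ball of radius \<open>e\<close> about \<open>x\<close> serves as
  the neighbourhood. Continuity is what carries compactness over to families of singletons.\<close>

lemma continuous_map_singleton: "continuous_map euclidean hyperspace_topology (\<lambda>x. {x})"
  unfolding hyperspace_topology_def Metric_space.continuous_map_to_metric[OF Metric_space_hyperspace]
proof (intro ballI allI impI)
  fix x :: 'a and e :: real assume "0 < e"
  then show "\<exists>U. openin euclidean U \<and> x \<in> U \<and>
      (\<forall>y\<in>U. {y} \<in> Metric_space.mball hyperspace hausdorff_dist {x} e)"
    by (intro exI[of _ "ball x e"])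
      (simp add: Metric_space.in_mball[OF Metric_space_hyperspace])
qed

section \<open>Symbol sequences and transition matrices\<close>

lemma symbol_dist_less_if_initial_agree:
  assumes "0 < e"
  obtains m where "\<And>s t. (\<And>i. i < m \<Longrightarrow> s i = t i) \<Longrightarrow> symbol_dist s t < e"
proof -
  have geo: "summable (\<lambda>i. (1 / 2) ^ i :: real)" by (rule summable_geometric) simp
  \<comment> \<open>For sequences agreeing below \<open>m\<close>, the distance is dominated by the
    geometric tail from \<open>m\<close> on. The tail depends on \<open>e\<close> only, so a single
    \<open>m\<close> serves all pairs.\<close>
  obtain m where m: "norm (\<Sum>i. (1 / 2) ^ (i + m) :: real) < e"
    using suminf_exist_split[OF assms geo] by blast
  have "symbol_dist s t < e" if agree: "\<And>i. i < m \<Longrightarrow> s i = t i" for s t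
  proof -
    let ?g = "\<lambda>i. (if s i = t i then 0 else 1) / 2 ^ i :: real"
    have "symbol_dist s t = (\<Sum>i. ?g (i + m))"
      unfolding symbol_dist_def suminf_split_initial_segment[OF summable_symbol_dist, of s t m]
      using agree by simp
    also have "\<dots> \<le> (\<Sum>i. (1 / 2) ^ (i + m))"
    proof (rule suminf_le)
      show "?g (i + m) \<le> (1 / 2) ^ (i + m)" for i by (simp add: power_one_over)
      show "summable (\<lambda>i. ?g (i + m))" by (rule summable_ignore_initial_segment[OF summable_symbol_dist])
      show "summable (\<lambda>i. (1 / 2) ^ (i + m) :: real)" by (rule summable_ignore_initial_segment[OF geo])
    qed
    finally show ?thesis using m by simp
  qed
  then show thesis by (rule that)
qed

lemma sum_ge_one_imp_ex_one:
  fixes g :: "'b \<Rightarrow> nat"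
  assumes "(\<Sum>i\<in>I. g i) \<ge> 1" and "\<And>i. i \<in> I \<Longrightarrow> g i \<in> {0, 1}"
  shows "\<exists>i\<in>I. g i = 1"
proof (rule ccontr)
  assume "\<not> ?thesis"
  then have "(\<Sum>i\<in>I. g i) = 0" using assms(2) by (intro sum.neutral) blast
  then show False using assms(1) by simp
qed

lemma transition_matrix_successor:
  assumes "transition_matrix N a" "i \<in> {1..N}"
  shows "\<exists>j\<in>{1..N}. a i j = 1"
  using assms unfolding transition_matrix_def by (intro sum_ge_one_imp_ex_one) blast+

lemma transition_matrix_predecessor:
  assumes "transition_matrix N a" "j \<in> {1..N}"
  shows "\<exists>i\<in>{1..N}. a i j = 1"
  using assms unfolding transition_matrix_def by (intro sum_ge_one_imp_ex_one) blast+

text \<open>Every row has an entry 1, so a choice of successors can be iterated from the symbol 1.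
  This later makes the families of singletons nonempty.\<close>

lemma subshift_nonempty:
  assumes "transition_matrix N a"
  shows "subshift N a \<noteq> {}"
proof -
  obtain g where g: "\<And>i. i \<in> {1..N} \<Longrightarrow> g i \<in> {1..N} \<and> a i (g i) = 1"
    using transition_matrix_successor[OF assms] by metis
  have "1 \<in> {1..N}" using assms by (simp add: transition_matrix_def)
  then have "(g ^^ k) 1 \<in> {1..N}" for k
    using g by (induction k) auto
  then have "(\<lambda>k. (g ^^ k) 1) \<in> subshift N a"
    using g unfolding subshift_def by simp
  then show ?thesis by blast
qed

section \<open>Orbits of the nonautonomous system\<close>

primrec orbit :: "(nat \<Rightarrow> 'a \<Rightarrow> 'a) \<Rightarrow> nat \<Rightarrow> nat \<Rightarrow> 'a \<Rightarrow> 'a" where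
  "orbit f n 0 x = x"
| "orbit f n (Suc k) x = f (n + k) (orbit f n k x)"

text \<open>The recursion appends the last map; splitting off the first map \<open>f n\<close>
  instead is what relates an orbit from time \<open>n\<close> to one from time \<open>Suc n\<close>,
  as the shift requires.\<close>

lemma orbit_Suc_start: "orbit f n (Suc k) x = orbit f (Suc n) k (f n x)"
  by (induction k) auto

lemma continuous_on_orbit:
  assumes "\<And>n. continuous_on UNIV (f n)"
  shows "continuous_on UNIV (orbit f n k)"
proof (induction k)
  case (Suc k)
  then show ?case
    using continuous_on_compose[OF Suc continuous_on_subset[OF assms subset_UNIV]]
    by (simp add: o_def)
qed simp

section \<open>Trapped points and their itineraries\<close>

locale disjoint_coupled_expansion =
  fixes f :: "nat \<Rightarrow> 'a::metric_space \<Rightarrow> 'a"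
    and N :: nat
    and a :: "nat \<Rightarrow> nat \<Rightarrow> nat"
    and V :: "nat \<Rightarrow> nat \<Rightarrow> 'a set"
  assumes compact_UNIV: "compact (UNIV :: 'a set)"
    and continuous: "\<And>n. continuous_on UNIV (f n)"
    and transition: "transition_matrix N a"
    and nonempty_closed: "\<And>i n. i \<in> {1..N} \<Longrightarrow> V i n \<noteq> {} \<and> closed (V i n)"
    and disjoint: "\<And>i j n. i \<in> {1..N} \<Longrightarrow> j \<in> {1..N} \<Longrightarrow> i \<noteq> j \<Longrightarrow> V i n \<inter> V j n = {}"
    and expanding: "weakly_coupled_expanding N a f V"
begin

lemma covers:
  assumes "i \<in> {1..N}" "j \<in> {1..N}" "a i j = 1"
  shows "V j (Suc n) \<subseteq> f n ` V i n"
  using expanding assms unfolding weakly_coupled_expanding_def by blast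

definition has_itinerary :: "nat \<Rightarrow> 'a \<Rightarrow> (nat \<Rightarrow> nat) \<Rightarrow> bool" where
  "has_itinerary n x s \<longleftrightarrow> s \<in> subshift N a \<and> (\<forall>k. orbit f n k x \<in> V (s k) (n + k))"

definition trapped :: "nat \<Rightarrow> 'a set" where
  "trapped n = {x. \<exists>s. has_itinerary n x s}"

text \<open>The description is proper on \<open>trapped n\<close>, by disjointness; elsewhere the
  value is unspecified.\<close>

definition itinerary :: "nat \<Rightarrow> 'a \<Rightarrow> nat \<Rightarrow> nat" where
  "itinerary n x = (THE s. has_itinerary n x s)"

lemma has_itinerary_unique:
  assumes "has_itinerary n x s" "has_itinerary n x t"
  shows "s = t"
proof
  fix k
  show "s k = t k"
    using assms disjoint[of "s k" "t k" "n + k"]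
    unfolding has_itinerary_def subshift_def by blast
qed

lemma itinerary_eq: "has_itinerary n x s \<Longrightarrow> itinerary n x = s"
  unfolding itinerary_def using has_itinerary_unique by blast

lemma has_itinerary_itinerary: "x \<in> trapped n \<Longrightarrow> has_itinerary n x (itinerary n x)"
  using itinerary_eq by (auto simp: trapped_def)

lemma has_itinerary_shift:
  assumes "has_itinerary n x s"
  shows "has_itinerary (Suc n) (f n x) (shift_map s)"
  \<comment> \<open>What remains after unfolding is the change of clock: step \<open>Suc k\<close>
    from time \<open>n\<close> is step \<open>k\<close> from time \<open>Suc n\<close>.\<close>
  using assms unfolding has_itinerary_def subshift_def shift_map_def
  by (auto simp flip: orbit_Suc_start simp del: orbit.simps)
    (metis add_Suc_right)+

lemma itinerary_shift:
  "x \<in> trapped n \<Longrightarrow> itinerary (Suc n) (f n x) = shift_map (itinerary n x)"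
  using has_itinerary_shift has_itinerary_itinerary itinerary_eq by blast

text \<open>Forward, itineraries shift. Backward, every column has an entry 1, so the first symbol
  of \<open>y\<close> has a predecessor \<open>i\<close>, and covering supplies a preimage of
  \<open>y\<close> in \<open>V i n\<close>.\<close>

lemma image_trapped: "f n ` trapped n = trapped (Suc n)"
proof
  show "f n ` trapped n \<subseteq> trapped (Suc n)"
    using has_itinerary_shift unfolding trapped_def by blast
  show "trapped (Suc n) \<subseteq> f n ` trapped n"
  proof
    fix y assume "y \<in> trapped (Suc n)"
    then obtain t where t: "has_itinerary (Suc n) y t" by (auto simp: trapped_def)
    then have t0: "t 0 \<in> {1..N}" "y \<in> V (t 0) (Suc n)"
      unfolding has_itinerary_def subshift_def by (blast, metis add_0_right orbit.simps(1))
    obtain i where i: "i \<in> {1..N}" "a i (t 0) = 1"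
      using transition_matrix_predecessor[OF transition t0(1)] by blast
    obtain x where x: "x \<in> V i n" "y = f n x"
      using covers[OF i(1) t0(1) i(2)] t0(2) by blast
    \<comment> \<open>\<open>case_nat i t\<close> is the sequence \<open>t\<close> with
      \<open>i\<close> put in front.\<close>
    have "orbit f n k x \<in> V (case_nat i t k) (n + k)" for k
    proof (cases k)
      case (Suc m)
      then show ?thesis
        using t x(2) by (simp add: has_itinerary_def orbit_Suc_start del: orbit.simps)
    qed (simp add: x)
    moreover have "case_nat i t \<in> subshift N a"
      using t i unfolding has_itinerary_def subshift_def by (auto split: nat.split)
    ultimately have "has_itinerary n x (case_nat i t)"
      by (simp add: has_itinerary_def)
    then show "y \<in> f n ` trapped n"
      using x(2) by (auto simp: trapped_def)
  qed
qed

section \<open>Compactness of the trapped sets\<close>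

lemma closed_orbit_vimage:
  assumes "i \<in> {1..N}"
  shows "closed {x. orbit f n k x \<in> V i m}"
  using closed_vimage[OF _ continuous_on_orbit[OF continuous]] nonempty_closed[OF assms]
  by (auto simp: vimage_def)

text \<open>A union over all itineraries need not be visibly closed. Admissibility only constrains
  consecutive symbols, so being trapped is a countable conjunction of conditions, each a finite
  union of closed sets.\<close>

lemma trapped_eq:
  "trapped n = (\<Inter>k. \<Union>i\<in>{1..N}. \<Union>j\<in>{j\<in>{1..N}. a i j = 1}.
     {x. orbit f n k x \<in> V i (n + k)} \<inter> {x. orbit f n (Suc k) x \<in> V j (n + Suc k)})"
    (is "_ = ?R")
proof
  show "trapped n \<subseteq> ?R"
    unfolding trapped_def has_itinerary_def subshift_def by blast
  show "?R \<subseteq> trapped n"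
  proof
    fix x assume x: "x \<in> ?R"
    then have "\<forall>k. \<exists>i. i \<in> {1..N} \<and> orbit f n k x \<in> V i (n + k)" by blast
    then obtain s where s: "\<And>k. s k \<in> {1..N}" "\<And>k. orbit f n k x \<in> V (s k) (n + k)"
      by metis
    \<comment> \<open>The witnesses \<open>i\<close>, \<open>j\<close> are chosen separately for
      each \<open>k\<close>; disjointness forces them to be \<open>s k\<close> and
      \<open>s (Suc k)\<close>, so the local transitions fit together into one sequence.\<close>
    have s_eq: "i = s k" if "i \<in> {1..N}" "orbit f n k x \<in> V i (n + k)" for i k
      using disjoint[OF that(1) s(1)[of k], of "n + k"] s(2)[of k] that(2) by blast
    have "a (s k) (s (Suc k)) = 1" for k
    proof -
      obtain i j where "i \<in> {1..N}" "j \<in> {1..N}" "a i j = 1" "orbit f n k x \<in> V i (n + k)"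
        "orbit f n (Suc k) x \<in> V j (n + Suc k)"
        using x by blast
      then show ?thesis using s_eq by blast
    qed
    then have "has_itinerary n x s"
      using s by (simp add: has_itinerary_def subshift_def)
    then show "x \<in> trapped n" by (auto simp: trapped_def)
  qed
qed

lemma compact_trapped: "compact (trapped n)"
proof -
  have "closed (trapped n)"
    unfolding trapped_eq
    by (intro closed_INT closed_UN ballI closed_Int closed_orbit_vimage) auto
  then show ?thesis
    using compact_Int_closed[OF compact_UNIV] by simp
qed

section \<open>Realisation of every admissible sequence\<close>

lemma finite_itinerary_realised:
  assumes "s \<in> subshift N a" "y \<in> V (s k) (n + k)"
  shows "\<exists>x. orbit f n k x = y \<and> (\<forall>j\<le>k. orbit f n j x \<in> V (s j) (n + j))"
  using assms(2)
\<comment> \<open>The end point is pulled back one step at a time through the coverings; the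
  induction hypothesis is applied to a preimage of \<open>y\<close>, hence \<open>y\<close> is
  arbitrary.\<close>
proof (induction k arbitrary: y)
  case (Suc k)
  have "V (s (Suc k)) (Suc (n + k)) \<subseteq> f (n + k) ` V (s k) (n + k)"
    using assms(1) by (intro covers) (auto simp: subshift_def)
  then obtain z where z: "z \<in> V (s k) (n + k)" "y = f (n + k) z"
    using Suc.prems by auto
  then obtain x where "orbit f n k x = z" "\<forall>j\<le>k. orbit f n j x \<in> V (s j) (n + j)"
    using Suc.IH by blast
  then show ?case
    using z Suc.prems by (intro exI[of _ x]) (auto simp: le_Suc_eq)
qed simp

text \<open>Finite itineraries extend to infinite ones by the finite intersection property of the
  compact space, applied to the closed conditions at the single times.\<close>

lemma itinerary_realised:
  assumes s: "s \<in> subshift N a"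
  shows "\<exists>x. has_itinerary n x s"
proof -
  define D where "D k = {x. orbit f n k x \<in> V (s k) (n + k)}" for k
  have s_range: "s j \<in> {1..N}" for j using s unfolding subshift_def by blast
  have "UNIV \<inter> (\<Inter>k\<in>UNIV. D k) \<noteq> {}"
  proof (rule compact_imp_fip_image[OF compact_UNIV])
    show "closed (D k)" for k
      unfolding D_def by (rule closed_orbit_vimage[OF s_range])
    fix I :: "nat set" assume "finite I"
    \<comment> \<open>The sets \<open>D k\<close> need not be nested, but a finite index set lies
      below some \<open>k\<close>, and a point realising \<open>s\<close> up to time
      \<open>k\<close> meets all its conditions at once.\<close>
    then obtain k where k: "I \<subseteq> {..k}" using finite_nat_iff_bounded_le by blast
    obtain y where "y \<in> V (s k) (n + k)" using nonempty_closed[OF s_range] by blast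
    then obtain x where "\<And>j. j \<le> k \<Longrightarrow> x \<in> D j"
      using finite_itinerary_realised[OF s] unfolding D_def by blast
    then show "UNIV \<inter> (\<Inter>j\<in>I. D j) \<noteq> {}" using k by blast
  qed
  then obtain x where "\<And>k. x \<in> D k" by blast
  then have "orbit f n k x \<in> V (s k) (n + k)" for k
    unfolding D_def by blast
  then show ?thesis using s by (auto simp: has_itinerary_def)
qed

lemma itinerary_image_trapped: "itinerary n ` trapped n = subshift N a"
proof
  show "itinerary n ` trapped n \<subseteq> subshift N a"
    using has_itinerary_itinerary by (auto simp: has_itinerary_def)
  show "subshift N a \<subseteq> itinerary n ` trapped n"
  proof
    fix s assume "s \<in> subshift N a"
    then obtain x where "has_itinerary n x s" using itinerary_realised by blast
    then show "s \<in> itinerary n ` trapped n"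
      using itinerary_eq unfolding trapped_def by blast
  qed
qed

section \<open>Local constancy of itineraries\<close>

lemma itinerary_initial_locally_constant:
  assumes x: "x \<in> trapped n"
  obtains d where "0 < d"
    "\<And>y i. y \<in> trapped n \<Longrightarrow> dist x y < d \<Longrightarrow> i < m \<Longrightarrow> itinerary n x i = itinerary n y i"
proof -
  let ?s = "itinerary n x"
  \<comment> \<open>Lying in the closed set \<open>V (?s i) (n + i)\<close> is not an open
    condition, but avoiding the finitely many other closed sets is. For trapped points, avoiding the
    others up to time \<open>m\<close> fixes the first \<open>m\<close> symbols.\<close>
  define U where
    "U = (\<Inter>i\<in>{..<m}. \<Inter>j\<in>{1..N} - {?s i}. - {y. orbit f n i y \<in> V j (n + i)})"
  have its: "?s i \<in> {1..N}" "orbit f n i x \<in> V (?s i) (n + i)" for i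
    using has_itinerary_itinerary[OF x] unfolding has_itinerary_def subshift_def by blast+
  have "open U"
    unfolding U_def by (intro open_INT ballI open_Compl closed_orbit_vimage) auto
  moreover have "x \<in> U"
    using its disjoint unfolding U_def by blast
  ultimately obtain d where d: "0 < d" "ball x d \<subseteq> U"
    by (meson openE)
  have "?s i = itinerary n y i" if y: "y \<in> trapped n" and "dist x y < d" "i < m" for y i
  proof (rule ccontr)
    assume neq: "?s i \<noteq> itinerary n y i"
    have "itinerary n y i \<in> {1..N}" "orbit f n i y \<in> V (itinerary n y i) (n + i)"
      using has_itinerary_itinerary[OF y] unfolding has_itinerary_def subshift_def by blast+
    moreover have "y \<in> U" using d(2) that by (auto simp: subset_iff)
    ultimately show False using neq \<open>i < m\<close> unfolding U_def by auto
  qed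
  then show thesis using that d(1) by blast
qed

section \<open>Transfer to the set-valued system\<close>

definition singletons :: "nat \<Rightarrow> 'a set set" where
  "singletons n = (\<lambda>x. {x}) ` trapped n"

lemma singletons_subset_hyperspace: "singletons n \<subseteq> hyperspace"
  by (auto simp: singletons_def)

lemma compactin_singletons: "compactin hyperspace_topology (singletons n)"
  unfolding singletons_def
  by (rule image_compactin[OF _ continuous_map_singleton]) (simp add: compact_trapped)

lemma singletons_subset: "singletons n \<subseteq> (\<Union>i\<in>{1..N}. compact_subsets_of (V i n))"
proof -
  have "\<exists>i\<in>{1..N}. x \<in> V i n" if "x \<in> trapped n" for x
    using has_itinerary_itinerary[OF that] unfolding has_itinerary_def subshift_def
    by (metis (mono_tags, lifting) add_0_right mem_Collect_eq orbit.simps(1))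
  then show ?thesis by (auto simp: singletons_def compact_subsets_of_def)
qed

lemma induced_map_singletons: "induced_map (f n) ` singletons n = singletons (Suc n)"
  unfolding singletons_def image_trapped[symmetric] by (simp add: image_image induced_map_def)

text \<open>\<open>the_elem\<close> recovers the point from its singleton. Closeness in the symbol
  metric needs only finitely many equal symbols, and these are locally constant.\<close>

lemma continuous_map_itinerary:
  "continuous_map (subtopology hyperspace_topology (singletons n)) (subshift_topology N a)
     (\<lambda>B. itinerary n (the_elem B))"
  unfolding subshift_topology_def Metric_space.continuous_map_to_metric[OF Metric_space_subshift]
proof (intro ballI allI impI)
  interpret H: Metric_space hyperspace "hausdorff_dist :: 'a set \<Rightarrow> 'a set \<Rightarrow> real"
    by (rule Metric_space_hyperspace)
  interpret S: Metric_space "subshift N a" symbol_dist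
    by (rule Metric_space_subshift)
  fix B and e :: real
  assume "B \<in> topspace (subtopology hyperspace_topology (singletons n))" and "0 < e"
  then obtain x where x: "x \<in> trapped n" "B = {x}"
    by (auto simp: singletons_def)
  obtain m where m: "\<And>s t. (\<And>i. i < m \<Longrightarrow> s i = t i) \<Longrightarrow> symbol_dist s t < e"
    using symbol_dist_less_if_initial_agree[OF \<open>0 < e\<close>] by blast
  obtain d where d: "0 < d"
    "\<And>y i. y \<in> trapped n \<Longrightarrow> dist x y < d \<Longrightarrow> i < m \<Longrightarrow> itinerary n x i = itinerary n y i"
    using itinerary_initial_locally_constant[OF x(1)] by blast
  \<comment> \<open>On singletons the Hausdorff ball of radius \<open>d\<close> is the ball of
    radius \<open>d\<close> about \<open>x\<close>, so the bound on \<open>dist x y\<close> applies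
    to it.\<close>
  let ?U = "H.mball B d \<inter> singletons n"
  have "openin (subtopology hyperspace_topology (singletons n)) ?U"
    unfolding hyperspace_topology_def by (intro openin_subtopology_Int H.openin_mball)
  moreover have "B \<in> ?U"
    using x d(1) by (auto simp: singletons_def)
  moreover have "itinerary n (the_elem B') \<in> S.mball (itinerary n (the_elem B)) e"
    if "B' \<in> ?U" for B'
    using that x d(2) m itinerary_image_trapped[of n] by (auto simp: singletons_def)
  ultimately show "\<exists>U. openin (subtopology hyperspace_topology (singletons n)) U \<and> B \<in> U \<and>
      (\<forall>B'\<in>U. itinerary n (the_elem B') \<in> S.mball (itinerary n (the_elem B)) e)"
    by blast
qed

lemma subsystem_semiconjugate_singletons:
  "subsystem_semiconjugate hyperspace_topology (\<lambda>n. induced_map (f n)) singletons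
     (subshift_topology N a) shift_map"
proof -
  have "invariant_sequence hyperspace_topology (\<lambda>n. induced_map (f n)) singletons"
    by (simp add: invariant_sequence_def induced_map_singletons singletons_subset_hyperspace)
  moreover have "(\<lambda>B. itinerary n (the_elem B)) ` singletons n = topspace (subshift_topology N a)"
    for n
    by (simp add: singletons_def image_image itinerary_image_trapped subshift_topology_def
        Metric_space.topspace_mtopology[OF Metric_space_subshift])
  moreover have "itinerary (Suc n) (the_elem (induced_map (f n) B)) =
      shift_map (itinerary n (the_elem B))" if "B \<in> singletons n" for n B
    using that by (auto simp: singletons_def induced_map_def itinerary_shift)
  ultimately show ?thesis
    unfolding subsystem_semiconjugate_def
    by (intro conjI exI[of _ "\<lambda>n B. itinerary n (the_elem B)"])
      (auto simp: continuous_map_itinerary)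
qed

text \<open>The itinerary map is onto a nonempty subshift, so its domain cannot be empty.\<close>

lemma singletons_nonempty: "singletons n \<noteq> {}"
  using itinerary_image_trapped[of n] subshift_nonempty[OF transition]
  by (auto simp: singletons_def)

end

theorem theorem4p2:
  fixes f :: "nat \<Rightarrow> 'a::metric_space \<Rightarrow> 'a"
    and N :: nat
    and a :: "nat \<Rightarrow> nat \<Rightarrow> nat"
    and V :: "nat \<Rightarrow> nat \<Rightarrow> 'a set"
  assumes "compact (UNIV :: 'a set)"
    and "\<And>n. continuous_on UNIV (f n)"
    and "transition_matrix N a"
    and "\<And>i n. i \<in> {1..N} \<Longrightarrow> V i n \<noteq> {} \<and> closed (V i n)"
    and "\<And>i j n. i \<in> {1..N} \<Longrightarrow> j \<in> {1..N} \<Longrightarrow> i \<noteq> j \<Longrightarrow> V i n \<inter> V j n = {}"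
    and "weakly_coupled_expanding N a f V"
  shows "\<exists>C :: nat \<Rightarrow> 'a set set.
    (\<forall>n. C n \<noteq> {} \<and>
         compactin hyperspace_topology (C n) \<and>
         C n \<subseteq> (\<Union>i\<in>{1..N}. compact_subsets_of (V i n)) \<and>
         induced_map (f n) ` C n = C (Suc n)) \<and>
    subsystem_semiconjugate hyperspace_topology (\<lambda>n. induced_map (f n)) C
      (subshift_topology N a) shift_map"
proof -
  interpret disjoint_coupled_expansion f N a V
    using assms by unfold_locales
  show ?thesis
    using singletons_nonempty compactin_singletons singletons_subset induced_map_singletons
      subsystem_semiconjugate_singletons
    by (intro exI[of _ singletons]) blast
qed

end
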